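(* Let $c_1>0$, $b_1=\frac{\sqrt{1+4c_1}-1}{2}$ and $b_4=\frac{1+\sqrt{1+4c_1}}{2}$ (so $b_1<\sqrt{c_1}<b_4$). Put $$F_1(\alpha)=\int_{\alpha}^{\sqrt{c_1}}\frac{(c_1-\rho^2)^{2m-1}}{\{\rho^{2m}-(c_1-\rho^2)^{2m}\}^{\frac{2m-1}{2m}}}\,d\rho\ \ (b_1\le\alpha\le\sqrt{c_1}),\qquad F_2(\alpha)=\int_{\sqrt{c_1}}^{\alpha}\frac{(\rho^2-c_1)^{2m-1}}{\{\rho^{2m}-(\rho^2-c_1)^{2m}\}^{\frac{2m-1}{2m}}}\,d\rho\ \ (\sqrt{c_1}\le\alpha\le b_4),$$ which are finite, and let $d_1=F_1(b_1)>0$, $d_3=F_2(b_4)>0$. In the $(\alpha,z)$ half-plane let $\Gamma$ be the curve obtained by traversing consecutively $G_1=\{(\alpha,-F_1(\alpha)):b_1\le\alpha\le\sqrt{c_1}\}$ with $\alpha$ increasing, $G_2=\{(\alpha,-F_2(\alpha)):\sqrt{c_1}\le\alpha\le b_4\}$ with $\alpha$ increasing, $G_3=\{(\alpha,F_2(\alpha)-2d_3):\sqrt{c_1}\le\alpha\le b_4\}$ with $\alpha$ decreasing, and $G_4=\{(\alpha,F_1(\alpha)-2d_3):b_1\le\alpha\le\sqrt{c_1}\}$ with $\alpha$ decreasing; $\Gamma$ runs from $(b_1,-d_1)$ to $(b_1,d_1-2d_3)$. Let $\Gamma^*$ be the curve obtained by concatenating the translates $\Gamma+k(0,2d_1-2d_3)$,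 $k\in\mathbb{Z}$, in increasing order of $k$. Then $\Gamma^*$ admits a regular $C^2$ parametrization $t\mapsto(\alpha^*(t),\beta^*(t))$, $t\in\mathbb{R}$, traversing it in this order, and the rotational surface $$f^*(t,v)=(\alpha^*(t)\cos v,\ \alpha^*(t)\sin v,\ \beta^*(t)),\qquad (t,v)\in\mathbb{R}\times[0,2\pi],$$ has a Birkhoff–Gauss map that is $C^1$ on the whole domain (with orientation: $\nabla\Phi(\eta)$ is a positive multiple of $f^*_t\times f^*_v$) and has constant Minkowski mean curvature $1$.
   Context: Fix an integer $m\ge 2$. Let $\Phi(x_1,x_2,x_3)=(x_1^2+x_2^2)^m+x_3^{2m}$ and let $\|\cdot\|$ be the norm on $\mathbb{R}^3$ whose unit sphere is $S=\{x\in\mathbb{R}^3:\Phi(x)=1\}$ (a smooth, strictly convex surface). For a surface given by a parametrization $f(s,v)$, its Birkhoff–Gauss map $\eta$ is the map into $S$ defined by requiring $\eta\in S$ and $\nabla\Phi(\eta)=\mu\, f_s\times f_v$ for some function $\mu>0$, where $\times$ is the standard cross product (so the tangent plane of $S$ at $\eta(p)$ is parallel to $T_pM$, and $d\eta_p$ is an endomorphism of $T_pM$). Where $\eta$ is $C^1$, the Minkowski mean curvature is $H=\tfrac12\operatorname{trace}(d\eta_p)$. *)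

theory Defs
  imports "HOL-Analysis.Analysis"
begin

definition Phi :: "nat \<Rightarrow> real^3 \<Rightarrow> real" where
  "Phi m x = ((x$1)^2 + (x$2)^2)^m + (x$3)^(2*m)"

definition b1 :: "real \<Rightarrow> real" where "b1 c1 = (sqrt (1 + 4*c1) - 1) / 2"
definition b4 :: "real \<Rightarrow> real" where "b4 c1 = (1 + sqrt (1 + 4*c1)) / 2"

text \<open>Integrands of F1 and F2 (exponent (2m-1)/(2m) via powr; at the finitely many
  endpoints where the base vanishes the value is irrelevant for the integral).\<close>
definition g1 :: "nat \<Rightarrow> real \<Rightarrow> real \<Rightarrow> real" where
  "g1 m c1 \<rho> = (c1 - \<rho>^2)^(2*m-1) /
     (\<rho>^(2*m) - (c1 - \<rho>^2)^(2*m)) powr ((2*real m - 1) / (2*real m))"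
definition g2 :: "nat \<Rightarrow> real \<Rightarrow> real \<Rightarrow> real" where
  "g2 m c1 \<rho> = (\<rho>^2 - c1)^(2*m-1) /
     (\<rho>^(2*m) - (\<rho>^2 - c1)^(2*m)) powr ((2*real m - 1) / (2*real m))"

definition F1 :: "nat \<Rightarrow> real \<Rightarrow> real \<Rightarrow> real" where
  "F1 m c1 \<alpha> = integral {\<alpha>..sqrt c1} (g1 m c1)"
definition F2 :: "nat \<Rightarrow> real \<Rightarrow> real \<Rightarrow> real" where
  "F2 m c1 \<alpha> = integral {sqrt c1..\<alpha>} (g2 m c1)"

definition d1 :: "nat \<Rightarrow> real \<Rightarrow> real" where "d1 m c1 = F1 m c1 (b1 c1)"
definition d3 :: "nat \<Rightarrow> real \<Rightarrow> real" where "d3 m c1 = F2 m c1 (b4 c1)"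

text \<open>A reference parametrization of Gamma by s in [0,4]: each piece G1..G4 is
  traversed over an interval of length 1, alpha moving linearly in the stated direction.\<close>
definition Gamma :: "nat \<Rightarrow> real \<Rightarrow> real \<Rightarrow> real \<times> real" where
  "Gamma m c1 s =
    (if s \<le> 1 then (let a = b1 c1 + s * (sqrt c1 - b1 c1) in (a, - F1 m c1 a))
     else if s \<le> 2 then (let a = sqrt c1 + (s - 1) * (b4 c1 - sqrt c1) in (a, - F2 m c1 a))
     else if s \<le> 3 then (let a = b4 c1 - (s - 2) * (b4 c1 - sqrt c1) in (a, F2 m c1 a - 2 * d3 m c1))
     else (let a = sqrt c1 - (s - 3) * (sqrt c1 - b1 c1) in (a, F1 m c1 a - 2 * d3 m c1)))"

definition Gamma_star :: "nat \<Rightarrow> real \<Rightarrow> real \<Rightarrow> real \<times> real" where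
  "Gamma_star m c1 s =
    (let k = \<lfloor>s / 4\<rfloor>; r = s - 4 * of_int k
     in (fst (Gamma m c1 r), snd (Gamma m c1 r) + of_int k * (2 * d1 m c1 - 2 * d3 m c1)))"

definition ptl_t :: "(real \<times> real \<Rightarrow> real^3) \<Rightarrow> real \<times> real \<Rightarrow> real^3" where
  "ptl_t f p = vector_derivative (\<lambda>t. f (t, snd p)) (at (fst p))"
definition ptl_v :: "(real \<times> real \<Rightarrow> real^3) \<Rightarrow> real \<times> real \<Rightarrow> real^3" where
  "ptl_v f p = vector_derivative (\<lambda>v. f (fst p, v)) (at (snd p))"

definition is_BG_map :: "nat \<Rightarrow> (real \<times> real \<Rightarrow> real^3) \<Rightarrow> (real \<times> real) set
     \<Rightarrow> (real \<times> real \<Rightarrow> real^3) \<Rightarrow> bool" where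
  "is_BG_map m f D \<eta> \<longleftrightarrow> (\<forall>p\<in>D. Phi m (\<eta> p) = 1 \<and>
      (\<exists>\<mu>>0. (Phi m has_derivative (\<lambda>h. (\<mu> *\<^sub>R cross3 (ptl_t f p) (ptl_v f p)) \<bullet> h)) (at (\<eta> p))))"

definition C1_on :: "(real \<times> real) set \<Rightarrow> (real \<times> real \<Rightarrow> real^3) \<Rightarrow> bool" where
  "C1_on D \<eta> \<longleftrightarrow> (\<exists>D'. (\<forall>p\<in>D. (\<eta> has_derivative blinfun_apply (D' p)) (at p within D))
                          \<and> continuous_on D D')"

text \<open>Minkowski mean curvature H = 1/2 trace(d eta_p), d eta_p viewed as endomorphism of
  T_pM = span{f_t, f_v}: d eta_p(f_t) = eta_t, d eta_p(f_v) = eta_v.\<close>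
definition mink_mean_curv_is :: "(real \<times> real \<Rightarrow> real^3) \<Rightarrow> (real \<times> real) set
     \<Rightarrow> (real \<times> real \<Rightarrow> real^3) \<Rightarrow> real \<times> real \<Rightarrow> real \<Rightarrow> bool" where
  "mink_mean_curv_is f D \<eta> p H \<longleftrightarrow> (\<forall>L. (\<eta> has_derivative L) (at p within D) \<longrightarrow>
      (\<exists>a b c d. L (1, 0) = a *\<^sub>R ptl_t f p + b *\<^sub>R ptl_v f p
              \<and> L (0, 1) = c *\<^sub>R ptl_t f p + d *\<^sub>R ptl_v f p
              \<and> (a + d) / 2 = H))"

definition rot_surface :: "(real \<Rightarrow> real) \<Rightarrow> (real \<Rightarrow> real) \<Rightarrow> real \<times> real \<Rightarrow> real^3" where
  "rot_surface \<alpha> \<beta> p = vector [\<alpha> (fst p) * cos (snd p), \<alpha> (fst p) * sin (snd p), \<beta> (fst p)]"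

end

theory Submission
  imports Defs
begin

text \<open>
  Along the rotational surface the Birkhoff--Gauss map is \<open>(u cos v, u sin v, w)\<close> with
  \<open>u^(2m) + w^(2m) = 1\<close>, and on each of the four arcs the integrands of \<open>F1\<close> and \<open>F2\<close> say
  exactly that \<open>u = \<alpha> - c1 / \<alpha>\<close>. So one reverses the construction: run through the smooth
  curve \<open>(u, w)\<close> and recover \<open>\<alpha>\<close> as the positive solution of \<open>\<alpha> - c1 / \<alpha> = u\<close>. Tangents of the
  profile and of the unit sphere being parallel, \<open>\<beta>' = (d\<alpha> / du) w'\<close>, which is smooth and hides the
  singularities of the integrands at \<open>w = 0\<close>. The principal curvatures are
  \<open>du / d\<alpha> = 1 + c1 / \<alpha>^2\<close> and \<open>u / \<alpha> = 1 - c1 / \<alpha>^2\<close>, with mean \<open>1\<close>.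
\<close>

section \<open>Integration through a monotone parametrization\<close>

text \<open>The composite of \<open>h\<close> with the inverse of \<open>f\<close> is continuous on
  the closed interval and an antiderivative of \<open>g\<close> in its interior, which is all the
  interior form of the fundamental theorem asks. Hence \<open>g\<close> may be singular, and
  \<open>f'\<close> may vanish, at the ends, as happens at \<open>b1 c1\<close> and
  \<open>b4 c1\<close>.\<close>

lemma has_integral_parametric:
  fixes f h g :: "real \<Rightarrow> real"
  assumes "p \<le> q"
    and cf: "continuous_on {p..q} f" and ch: "continuous_on {p..q} h"
    and df: "\<And>t. t \<in> {p<..<q} \<Longrightarrow> (f has_real_derivative f' t) (at t)"
    and dh: "\<And>t. t \<in> {p<..<q} \<Longrightarrow> (h has_real_derivative h' t) (at t)"
    and pos: "\<And>t. t \<in> {p<..<q} \<Longrightarrow> 0 < f' t"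
    and eq: "\<And>t. t \<in> {p<..<q} \<Longrightarrow> g (f t) * f' t = h' t"
  shows "(g has_integral (h q - h p)) {f p..f q}"
proof -
  have less: "f x < f y" if "p \<le> x" "x < y" "y \<le> q" for x y
  proof (rule DERIV_pos_imp_increasing_open[OF \<open>x < y\<close>])
    show "\<exists>y. DERIV f t :> y \<and> 0 < y" if "x < t" "t < y" for t
      using df[of t] pos[of t] that \<open>p \<le> x\<close> \<open>y \<le> q\<close> by auto
    show "continuous_on {x..y} f"
      using continuous_on_subset[OF cf] that by auto
  qed
  have inj: "inj_on f {p..q}"
    by (metis (full_types) atLeastAtMost_iff inj_onI less linorder_neqE_linordered_idom order_less_irrefl)
  have le: "f x \<le> f y" if "p \<le> x" "x \<le> y" "y \<le> q" for x y
    using less[of x y] that by (cases "x = y") auto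
  have im: "f ` {p..q} = {f p..f q}"
  proof
    show "f ` {p..q} \<subseteq> {f p..f q}" using le \<open>p \<le> q\<close> by auto
    show "{f p..f q} \<subseteq> f ` {p..q}"
    proof
      fix y assume "y \<in> {f p..f q}"
      then show "y \<in> f ` {p..q}"
        using IVT'[of f p y q] cf \<open>p \<le> q\<close> by (auto simp: image_iff)
    qed
  qed
  define k where "k = inv_into {p..q} f"
  have kf: "k (f t) = t" if "t \<in> {p..q}" for t
    unfolding k_def by (rule inv_into_f_f[OF inj that])
  have ck: "continuous_on {f p..f q} k"
    using continuous_on_inv[OF cf compact_Icc] kf im by metis
  have chk: "continuous_on {f p..f q} (\<lambda>x. h (k x))"
  proof (rule continuous_on_compose2[OF ch ck])
    show "k ` {f p..f q} \<subseteq> {p..q}" unfolding im[symmetric] using kf by auto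
  qed
  have fpq: "f p \<le> f q" using le \<open>p \<le> q\<close> by auto
  have der: "((\<lambda>x. h (k x)) has_vector_derivative g x) (at x)" if x: "x \<in> {f p<..<f q}" for x
  proof -
    have "x \<in> f ` {p..q}" using im x by auto
    then obtain t where t: "t \<in> {p..q}" "x = f t" by blast
    have tin: "t \<in> {p<..<q}" using t x by (cases "t = p"; cases "t = q") auto
    have fk: "f (k y) = y" if "f p < y" "y < f q" for y
    proof -
      have "y \<in> f ` {p..q}" using that im by auto
      then obtain s where "s \<in> {p..q}" "y = f s" by blast
      then show ?thesis using kf by simp
    qed
    have ktx: "k x = t" using kf t by simp
    have isc: "isCont k x"
      using x continuous_on_interior[OF ck, of x] by simp
    have "(k has_real_derivative inverse (f' t)) (at x)"
    proof (rule DERIV_inverse_function[where f = f and a = "f p" and b = "f q"])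
      show "DERIV f (k x) :> f' t" using df tin ktx by simp
      show "f' t \<noteq> 0" using pos tin by force
    qed (use x fk isc in auto)
    then have "((\<lambda>x. h (k x)) has_real_derivative h' t * inverse (f' t)) (at x)"
      using DERIV_chain2[of h "h' t" k x] dh[OF tin] ktx by simp
    moreover have "h' t * inverse (f' t) = g x"
      using eq[OF tin] pos[OF tin] t by (auto simp: field_simps)
    ultimately show ?thesis by (simp add: has_real_derivative_iff_has_vector_derivative)
  qed
  have "(g has_integral (h (k (f q)) - h (k (f p)))) {f p..f q}"
    by (rule fundamental_theorem_of_calculus_interior[OF fpq chk der])
  then show ?thesis using kf \<open>p \<le> q\<close> by simp
qed

section \<open>Quasi-periodic extension of monotone functions\<close>

text \<open>Continues \<open>\<psi>\<close> from one period of length \<open>p\<close> to the line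
  so that a shift by \<open>p\<close> adds \<open>q\<close>. With \<open>p = 2*pi\<close> and
  \<open>q = 4\<close> it will convert the angle into the parameter of
  \<open>Gamma_star\<close>.\<close>

definition quasi_periodic :: "real \<Rightarrow> real \<Rightarrow> (real \<Rightarrow> real) \<Rightarrow> real \<Rightarrow> real" where
  "quasi_periodic p q \<psi> x = \<psi> (x - p * \<lfloor>x / p\<rfloor>) + q * \<lfloor>x / p\<rfloor>"

lemma floor_remainder:
  fixes x p :: real
  assumes "p > 0"
  shows "x - p * \<lfloor>x / p\<rfloor> \<in> {0..<p}"
proof -
  have "\<lfloor>x / p\<rfloor> \<le> x / p" "x / p < \<lfloor>x / p\<rfloor> + 1" by linarith+
  then have "\<lfloor>x / p\<rfloor> * p \<le> x" "x < (\<lfloor>x / p\<rfloor> + 1) * p"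
    using assms by (simp_all only: pos_le_divide_eq pos_divide_less_eq)
  then show ?thesis by (simp add: algebra_simps)
qed

locale monotone_period =
  fixes p q :: real and \<psi> :: "real \<Rightarrow> real"
  assumes p: "p > 0" and q: "q > 0"
    and mono: "strict_mono_on {0..p} \<psi>" and start: "\<psi> 0 = 0" and stop: "\<psi> p = q"
begin

lemma remainder_range: "\<psi> (x - p * \<lfloor>x / p\<rfloor>) \<in> {0..<q}"
proof -
  let ?r = "x - p * \<lfloor>x / p\<rfloor>"
  have r: "?r \<in> {0..<p}" by (rule floor_remainder[OF p])
  then have "\<psi> ?r < \<psi> p" using strict_mono_onD[OF mono, of ?r p] by auto
  moreover have "\<psi> 0 \<le> \<psi> ?r"
    using strict_mono_onD[OF mono, of 0 ?r] r by (cases "?r = 0") auto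
  ultimately show ?thesis using start stop by simp
qed

text \<open>The remainder lies in \<open>{0..<q}\<close>, so source and target are cut into periods
  with the same index. This lets the floor inside \<open>Gamma_star\<close> be evaluated.\<close>

lemma floor_quasi_periodic: "\<lfloor>quasi_periodic p q \<psi> x / q\<rfloor> = \<lfloor>x / p\<rfloor>"
proof (rule floor_unique)
  show "\<lfloor>x / p\<rfloor> \<le> quasi_periodic p q \<psi> x / q"
    using remainder_range[of x] q by (simp add: quasi_periodic_def field_simps)
  show "quasi_periodic p q \<psi> x / q < real_of_int \<lfloor>x / p\<rfloor> + 1"
    using remainder_range[of x] q by (simp add: quasi_periodic_def field_simps)
qed

lemma strict_mono_quasi_periodic: "strict_mono (quasi_periodic p q \<psi>)"
proof (rule strict_monoI)
  fix x y :: real assume "x < y"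
  then have "x / p \<le> y / p" using p by (simp add: divide_right_mono)
  then have le: "\<lfloor>x / p\<rfloor> \<le> \<lfloor>y / p\<rfloor>" by (rule floor_mono)
  show "quasi_periodic p q \<psi> x < quasi_periodic p q \<psi> y"
  proof (cases "\<lfloor>x / p\<rfloor> = \<lfloor>y / p\<rfloor>")
    case True
    have "\<psi> (x - p * \<lfloor>x / p\<rfloor>) < \<psi> (y - p * \<lfloor>y / p\<rfloor>)"
      using True floor_remainder[OF p, of x] floor_remainder[OF p, of y] \<open>x < y\<close>
      by (intro strict_mono_onD[OF mono]) auto
    then show ?thesis by (simp add: quasi_periodic_def True)
  next
    case False
    then have "\<lfloor>x / p\<rfloor> + 1 \<le> \<lfloor>y / p\<rfloor>" using le by simp
    \<comment> \<open>The values over period \<open>k\<close> lie in \<open>{q*k..<q*k+q}\<close>,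
      so different periods are separated by their indices alone.\<close>
    then have "real_of_int \<lfloor>x / p\<rfloor> + 1 \<le> real_of_int \<lfloor>y / p\<rfloor>" by linarith
    then have "q * \<lfloor>x / p\<rfloor> + q \<le> q * \<lfloor>y / p\<rfloor>"
      using mult_left_mono[of _ _ q] q by (fastforce simp: distrib_left)
    then show ?thesis
      using remainder_range[of x] remainder_range[of y] by (simp add: quasi_periodic_def)
  qed
qed

lemma surj_quasi_periodic:
  assumes onto: "{0..q} \<subseteq> \<psi> ` {0..p}"
  shows "surj (quasi_periodic p q \<psi>)"
proof -
  have "\<exists>x. y = quasi_periodic p q \<psi> x" for y
  proof -
    define k where "k = \<lfloor>y / q\<rfloor>"
    have r: "y - q * k \<in> {0..<q}" unfolding k_def by (rule floor_remainder[OF q])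
    then have "y - q * k \<in> \<psi> ` {0..p}" using onto by auto
    then obtain t where t: "t \<in> {0..p}" "y - q * k = \<psi> t" by blast
    \<comment> \<open>\<open>t = p\<close> would give the remainder \<open>q\<close>, which is
      excluded; thus \<open>t\<close> is a genuine remainder modulo \<open>p\<close>.\<close>
    have "t \<noteq> p" using t r stop by auto
    then have "\<lfloor>(t + p * k) / p\<rfloor> = k"
      using t p by (intro floor_unique) (auto simp: field_simps)
    then have "y = quasi_periodic p q \<psi> (t + p * k)"
      using t by (simp add: quasi_periodic_def)
    then show ?thesis by blast
  qed
  then show ?thesis by (auto simp: surj_def)
qed

end

section \<open>Vectors and the gauge function\<close>

text \<open>As a linear combination of fixed vectors, the list constructor is open to the generic
  rules for derivatives and continuity.\<close>

lemma vector_3_axis: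
  "(vector [a, b, c] :: real^3) = a *\<^sub>R axis 1 1 + b *\<^sub>R axis 2 1 + c *\<^sub>R axis 3 1"
  by (simp add: vec_eq_iff forall_3 axis_def)

lemma has_derivative_vector_3:
  assumes "(f has_derivative f') F" "(g has_derivative g') F" "(h has_derivative h') F"
  shows "((\<lambda>x. vector [f x, g x, h x] :: real^3) has_derivative
    (\<lambda>y. vector [f' y, g' y, h' y])) F"
  unfolding vector_3_axis by (intro derivative_intros assms)

lemma has_vector_derivative_vector_3:
  assumes "(f has_real_derivative f') (at t)" "(g has_real_derivative g') (at t)"
    "(h has_real_derivative h') (at t)"
  shows "((\<lambda>x. vector [f x, g x, h x] :: real^3) has_vector_derivative vector [f', g', h']) (at t)"
proof -
  have "((\<lambda>x. vector [f x, g x, h x] :: real^3) has_derivative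
      (\<lambda>y. vector [f' * y, g' * y, h' * y])) (at t)"
    using assms unfolding has_field_derivative_def by (rule has_derivative_vector_3)
  moreover have "(\<lambda>y. vector [f' * y, g' * y, h' * y] :: real^3) = (\<lambda>y. y *\<^sub>R vector [f', g', h'])"
    by (rule ext) (simp add: vec_eq_iff forall_3)
  ultimately show ?thesis by (simp add: has_vector_derivative_def)
qed

lemma continuous_on_vector_3:
  assumes "continuous_on S f" "continuous_on S g" "continuous_on S h"
  shows "continuous_on S (\<lambda>x. vector [f x, g x, h x] :: real^3)"
  unfolding vector_3_axis by (intro continuous_intros assms)

lemma inner_real_3: "(x :: real^3) \<bullet> y = x$1 * y$1 + x$2 * y$2 + x$3 * y$3"
  by (simp add: inner_vec_def sum_3)

definition grad_Phi :: "nat \<Rightarrow> real^3 \<Rightarrow> real^3" where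
  "grad_Phi m x = (2 * real m) *\<^sub>R vector [((x$1)^2 + (x$2)^2)^(m-1) * x$1,
     ((x$1)^2 + (x$2)^2)^(m-1) * x$2, (x$3)^(2*m-1)]"

lemma has_derivative_Phi: "(Phi m has_derivative (\<lambda>h. grad_Phi m x \<bullet> h)) (at x)"
proof -
  have c: "((\<lambda>x :: real^3. x $ i) has_derivative (\<lambda>h. h $ i)) (at x)" for i
    by (rule bounded_linear.has_derivative[OF bounded_linear_vec_nth]) (rule has_derivative_ident)
  have "((\<lambda>x :: real^3. ((x$1)^2 + (x$2)^2)^m + (x$3)^(2*m)) has_derivative
      (\<lambda>h. grad_Phi m x \<bullet> h)) (at x)"
    by (rule derivative_eq_intros c refl)+
      (simp add: fun_eq_iff inner_real_3 grad_Phi_def algebra_simps)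
  then show ?thesis by (simp add: Phi_def[abs_def])
qed

text \<open>Derivatives are unique, so the condition in \<open>is_BG_map\<close> becomes an equation
  between vectors.\<close>

lemma has_derivative_Phi_iff:
  "(Phi m has_derivative (\<lambda>h. n \<bullet> h)) (at x) \<longleftrightarrow> grad_Phi m x = n"
proof
  assume "(Phi m has_derivative (\<lambda>h. n \<bullet> h)) (at x)"
  then have "(\<lambda>h. n \<bullet> h) = (\<lambda>h. grad_Phi m x \<bullet> h)"
    by (rule has_derivative_unique[OF _ has_derivative_Phi])
  then show "grad_Phi m x = n" by (metis vector_eq_rdot)
qed (use has_derivative_Phi in auto)

text \<open>Taking squared lengths of both sides gives \<open>r^(2*m-1) = (k^2 * s)^(2*m-1)\<close>,
  hence \<open>r = k^2 * s\<close>. The radial factors then cancel, except at the origin, where both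
  points vanish.\<close>

lemma radial_scaling:
  fixes x y x' y' k :: real
  assumes m: "m \<ge> 1" and k: "k > 0"
    and 1: "(x^2 + y^2)^(m-1) * x = k^(2*m-1) * ((x'^2 + y'^2)^(m-1) * x')"
    and 2: "(x^2 + y^2)^(m-1) * y = k^(2*m-1) * ((x'^2 + y'^2)^(m-1) * y')"
  shows "x = k * x' \<and> y = k * y'"
proof -
  define r where "r = x^2 + y^2"
  define s where "s = x'^2 + y'^2"
  have r0: "r \<ge> 0" and s0: "s \<ge> 0" by (simp_all add: r_def s_def)
  obtain n where n: "m = Suc n" using m by (cases m) auto
  have odd_pow: "(z^(m-1) * a)^2 + (z^(m-1) * b)^2 = z^(2*m-1)" if "z = a^2 + b^2" for z a b :: real
  proof -
    have "(z^(m-1) * a)^2 + (z^(m-1) * b)^2 = (z^n)^2 * z"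
      unfolding n that by (simp add: power_mult_distrib distrib_left)
    also have "\<dots> = z^(2*m-1)" by (simp add: n mult.commute flip: power_mult)
    finally show ?thesis .
  qed
  have "r^(2*m-1) = (r^(m-1) * x)^2 + (r^(m-1) * y)^2"
    using odd_pow[OF r_def] by simp
  also have "\<dots> = (k^(2*m-1))^2 * ((s^(m-1) * x')^2 + (s^(m-1) * y')^2)"
    unfolding r_def 1 2 by (simp add: s_def power_mult_distrib distrib_left)
  also have "(s^(m-1) * x')^2 + (s^(m-1) * y')^2 = s^(2*m-1)"
    by (rule odd_pow[OF s_def])
  also have "(k^(2*m-1))^2 * s^(2*m-1) = (k^2 * s)^(2*m-1)"
    by (simp only: power_mult_distrib power_mult[symmetric] mult.commute)
  finally have "r^Suc (2*n) = (k^2 * s)^Suc (2*n)" by (simp add: n)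
  then have rs: "r = k^2 * s" by (rule power_inject_base) (use r0 s0 in auto)
  show ?thesis
  proof (cases "s = 0")
    case True
    then have "r = 0" using rs by simp
    then show ?thesis using True by (simp add: r_def s_def sum_power2_eq_zero_iff)
  next
    case False
    have "r^(m-1) = k^(2*n) * s^n" by (simp add: rs n power_mult_distrib power_mult)
    then have "k^(2*n) * s^n * x = k^(2*n) * s^n * (k * x')"
      "k^(2*n) * s^n * y = k^(2*n) * s^n * (k * y')"
      using 1 2 by (simp_all add: r_def[symmetric] s_def[symmetric] n algebra_simps)
    then show ?thesis using False k by simp
  qed
qed

text \<open>A Birkhoff--Gauss map is pinned down only on the domain, so regularity and curvature
  have to pass between maps that agree there.\<close>

lemma C1_on_cong:
  assumes "C1_on D \<eta>" "\<And>p. p \<in> D \<Longrightarrow> \<theta> p = \<eta> p"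
  shows "C1_on D \<theta>"
  using assms unfolding C1_on_def by (metis has_derivative_transform)

lemma mink_mean_curv_is_cong:
  assumes "mink_mean_curv_is f D \<eta> p H" "\<And>p. p \<in> D \<Longrightarrow> \<theta> p = \<eta> p" "p \<in> D"
  shows "mink_mean_curv_is f D \<theta> p H"
  using assms unfolding mink_mean_curv_is_def by (metis has_derivative_transform)

text \<open>The gradient is positively homogeneous of odd degree, so parallel gradients force
  proportional points, and two proportional points of the unit sphere coincide.\<close>
lemma unit_sphere_eqI:
  assumes m: "m \<ge> 1" and "Phi m x = 1" "Phi m y = 1" and l: "l > 0"
    and g: "grad_Phi m x = l *\<^sub>R grad_Phi m y"
  shows "x = y"
proof -
  have odd: "odd (2*m-1)" using m by (cases m) auto
  \<comment> \<open>The gradient is homogeneous of degree \<open>2*m-1\<close>, so this root is the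
    expected ratio of \<open>x\<close> to \<open>y\<close>.\<close>
  define k where "k = root (2*m-1) l"
  have k: "k > 0" "k^(2*m-1) = l"
    using l m by (auto simp: k_def intro!: real_root_pow_pos)
  have eqs: "((x$1)^2 + (x$2)^2)^(m-1) * x$1 = l * (((y$1)^2 + (y$2)^2)^(m-1) * y$1)"
    "((x$1)^2 + (x$2)^2)^(m-1) * x$2 = l * (((y$1)^2 + (y$2)^2)^(m-1) * y$2)"
    "(x$3)^(2*m-1) = l * (y$3)^(2*m-1)"
    using g m by (simp_all add: grad_Phi_def vec_eq_iff forall_3)
  have 12: "x$1 = k * y$1 \<and> x$2 = k * y$2"
    by (rule radial_scaling[OF m k(1)]) (simp_all only: k(2) eqs)
  have "(x$3)^(2*m-1) = (k * y$3)^(2*m-1)" using eqs(3) k by (simp add: power_mult_distrib)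
  then have 3: "x$3 = k * y$3" 
    by (metis odd odd_real_root_power_cancel)
  have "(k * y$1)^2 + (k * y$2)^2 = k^2 * ((y$1)^2 + (y$2)^2)"
    by (simp add: power_mult_distrib distrib_left)
  then have "Phi m x = (k^2 * ((y$1)^2 + (y$2)^2))^m + (k * y$3)^(2*m)"
    by (simp only: Phi_def 12 3)
  also have "\<dots> = k^(2*m) * Phi m y"
    unfolding Phi_def power_mult_distrib by (simp add: power_mult distrib_left)
  finally have "k^(2*m) = 1" using assms by simp
  then have "k = 1" using power_eq_iff_eq_base[of "2*m" k 1] k(1) m by simp
  then show ?thesis using 12 3 by (simp add: vec_eq_iff forall_3)
qed

section \<open>The profile curve\<close>

text \<open>The unit circle \<open>(u, w)\<close> of the norm is parametrized by the polar angle, up to reflection,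
  and \<open>A\<close> inverts \<open>\<alpha> \<mapsto> \<alpha> - c1 / \<alpha>\<close>.\<close>
locale profile =
  fixes m :: nat and c1 :: real
  assumes m: "m \<ge> 1" and c1: "c1 > 0"
begin

lemma two_m: "2 * m = Suc (2 * m - 1)" and odd_2m1: "odd (2 * m - 1)"
  using m by (cases m; simp)+

text \<open>\<open>P t\<close> is the gauge of the Euclidean unit point
  \<open>(- cos t, sin t)\<close>, \<open>M t\<close> rescales that point to gauge 1, and
  \<open>K t = M t / P t\<close> is the common factor of both derivatives. The minus sign makes
  \<open>u\<close> increase from -1 to 1 on \<open>{0..pi}\<close>. Suffixes 1 and 2 mark
  derivatives.\<close>

definition P :: "real \<Rightarrow> real" where "P t = cos t^(2*m) + sin t^(2*m)"
definition P1 :: "real \<Rightarrow> real" where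
  "P1 t = 2 * real m * (sin t^(2*m-1) * cos t - cos t^(2*m-1) * sin t)"
definition M :: "real \<Rightarrow> real" where "M t = P t powr (- 1 / (2 * real m))"
definition K :: "real \<Rightarrow> real" where "K t = P t powr (- 1 / (2 * real m) - 1)"
definition K1 :: "real \<Rightarrow> real" where
  "K1 t = (- 1 / (2 * real m) - 1) * P t powr (- 1 / (2 * real m) - 1 - 1) * P1 t"
definition u :: "real \<Rightarrow> real" where "u t = - cos t * M t"
definition w :: "real \<Rightarrow> real" where "w t = sin t * M t"
definition u1 :: "real \<Rightarrow> real" where "u1 t = sin t^(2*m-1) * K t"
definition w1 :: "real \<Rightarrow> real" where "w1 t = cos t^(2*m-1) * K t"
definition u2 :: "real \<Rightarrow> real" where
  "u2 t = real (2*m-1) * sin t^(2*m-2) * cos t * K t + sin t^(2*m-1) * K1 t"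
definition w2 :: "real \<Rightarrow> real" where
  "w2 t = - (real (2*m-1) * cos t^(2*m-2) * sin t * K t) + cos t^(2*m-1) * K1 t"

lemma P_pos: "P t > 0"
proof -
  have "cos t \<noteq> 0 \<or> sin t \<noteq> 0" using sin_cos_squared_add[of t] by (cases "cos t = 0") auto
  then have "cos t^(2*m) \<noteq> 0 \<or> sin t^(2*m) \<noteq> 0" using power_not_zero by blast
  moreover have "cos t^(2*m) \<ge> 0" "sin t^(2*m) \<ge> 0" by (simp_all add: power_mult)
  ultimately show ?thesis unfolding P_def by linarith
qed

lemma M_pos: "M t > 0" and K_pos: "K t > 0"
  using P_pos[of t] by (auto simp: M_def K_def)

lemma M_eq: "M t = K t * P t"
  using P_pos[of t] by (simp add: M_def K_def powr_diff)

lemma M_power: "M t^(2*m) * P t = 1"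
proof -
  have "M t^(2*m) = M t powr (real (2*m))" using M_pos[of t] by (simp only: powr_realpow)
  also have "\<dots> = P t powr (- 1)" using m by (simp add: M_def powr_powr)
  also have "\<dots> = 1 / P t" using P_pos[of t] by (simp add: powr_minus_divide)
  finally show ?thesis using P_pos[of t] by simp
qed

lemma uw_unit: "u t^(2*m) + w t^(2*m) = 1"
proof -
  have "u t^(2*m) + w t^(2*m) = M t^(2*m) * P t"
    by (simp add: u_def w_def P_def power_mult_distrib algebra_simps)
  then show ?thesis by (simp only: M_power)
qed

lemma P_deriv: "(P has_real_derivative P1 t) (at t)"
  unfolding P_def[abs_def]
  by (rule derivative_eq_intros refl)+ (use m in \<open>simp add: P1_def algebra_simps\<close>)

lemma M_deriv: "(M has_real_derivative - 1 / (2 * real m) * K t * P1 t) (at t)"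
  unfolding M_def[abs_def] K_def
  using DERIV_fun_powr[OF P_deriv P_pos, where r = "- 1 / (2 * real m)"] by simp

lemma K_deriv: "(K has_real_derivative K1 t) (at t)"
  using DERIV_fun_powr[OF P_deriv P_pos, where r = "- 1 / (2 * real m) - 1"]
  unfolding K_def[abs_def] K1_def by simp

text \<open>After writing \<open>M\<close> as \<open>K * P\<close>, the terms in
  \<open>cos t^(2*m) * sin t\<close> cancel and the rest is \<open>K t * sin t^(2*m-1)\<close> times
  the Pythagorean sum. The derivative of \<open>w\<close> collapses in the same way.\<close>

lemma u_deriv: "(u has_real_derivative u1 t) (at t)"
proof -
  define q where "q = 2*m-1"
  have q: "2 * m = Suc q" unfolding q_def by (rule two_m)
  have "(u has_real_derivative sin t * M t - cos t * (- 1 / (2 * real m) * K t * P1 t)) (at t)"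
    unfolding u_def[abs_def] by (rule derivative_eq_intros M_deriv refl)+ simp
  also have "sin t * M t - cos t * (- 1 / (2 * real m) * K t * P1 t)
      = K t * (sin t^q * (sin t * sin t + cos t * cos t))"
    using m unfolding M_eq P1_def P_def q_def[symmetric] q
    by (simp add: algebra_simps del: sin_cos_squared_add3)
  finally show ?thesis
    by (simp add: u1_def q_def mult.commute add.commute[of "sin t * sin t"])
qed

lemma w_deriv: "(w has_real_derivative w1 t) (at t)"
proof -
  define q where "q = 2*m-1"
  have q: "2 * m = Suc q" unfolding q_def by (rule two_m)
  have "(w has_real_derivative cos t * M t + sin t * (- 1 / (2 * real m) * K t * P1 t)) (at t)"
    unfolding w_def[abs_def] by (rule derivative_eq_intros M_deriv refl)+ simp
  also have "cos t * M t + sin t * (- 1 / (2 * real m) * K t * P1 t)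
      = K t * (cos t^q * (sin t * sin t + cos t * cos t))"
    using m unfolding M_eq P1_def P_def q_def[symmetric] q
    by (simp add: algebra_simps del: sin_cos_squared_add3)
  finally show ?thesis
    by (simp add: w1_def q_def mult.commute add.commute[of "sin t * sin t"])
qed

lemma u1_deriv: "(u1 has_real_derivative u2 t) (at t)"
  unfolding u1_def[abs_def]
  by (rule derivative_eq_intros K_deriv refl)+ (simp add: u2_def algebra_simps numeral_2_eq_2)

lemma w1_deriv: "(w1 has_real_derivative w2 t) (at t)"
  unfolding w1_def[abs_def]
  by (rule derivative_eq_intros K_deriv refl)+ (simp add: w2_def algebra_simps numeral_2_eq_2)

lemmas continuous_uw =
  DERIV_continuous_on[OF has_field_derivative_at_within, OF u_deriv]
  DERIV_continuous_on[OF has_field_derivative_at_within, OF w_deriv]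
  DERIV_continuous_on[OF has_field_derivative_at_within, OF u1_deriv]
  DERIV_continuous_on[OF has_field_derivative_at_within, OF w1_deriv]

lemma continuous_u2: "continuous_on UNIV u2" and continuous_w2: "continuous_on UNIV w2"
proof -
  note [continuous_intros] =
    DERIV_continuous_on[OF has_field_derivative_at_within, OF P_deriv]
    DERIV_continuous_on[OF has_field_derivative_at_within, OF K_deriv]
  have "continuous_on UNIV (\<lambda>t. P t powr (- 1 / (2 * real m) - 1 - 1))"
    by (intro continuous_intros) (use P_pos less_irrefl in metis)
  note [continuous_intros] = this
  have [continuous_intros]: "continuous_on UNIV K1"
    unfolding K1_def[abs_def] P1_def by (intro continuous_intros)
  show "continuous_on UNIV u2" "continuous_on UNIV w2"
    unfolding u2_def[abs_def] w2_def[abs_def] by (intro continuous_intros)+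
qed

section \<open>Solving the quadratic equation for the radius\<close>

definition R :: "real \<Rightarrow> real" where "R x = sqrt (x^2 + 4*c1)"
text \<open>The positive root of \<open>y^2 - x*y - c1 = 0\<close>, whose discriminant is
  \<open>R x^2\<close>. It is smooth on the whole line, so one formula covers radii on both sides of
  \<open>sqrt c1\<close>.\<close>

definition A :: "real \<Rightarrow> real" where "A x = (x + R x) / 2"
definition A1 :: "real \<Rightarrow> real" where "A1 x = A x / R x"
definition A2 :: "real \<Rightarrow> real" where "A2 x = 2 * c1 / R x^3"

lemma R_pos: "R x > 0" and R_sq: "R x^2 = x^2 + 4*c1"
proof -
  have "x^2 + 4*c1 > 0" using c1 by (simp add: add_nonneg_pos)
  then show "R x > 0" "R x^2 = x^2 + 4*c1" by (auto simp: R_def)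
qed

lemma A_pos: "A x > 0"
proof -
  have "\<bar>x\<bar>^2 < R x^2" using c1 by (simp add: R_sq)
  then have "\<bar>x\<bar> < R x" by (rule power_less_imp_less_base) (use R_pos[of x] in simp)
  then show ?thesis by (simp add: A_def)
qed

lemma A1_pos: "A1 x > 0"
  using A_pos R_pos by (simp add: A1_def)

lemma A_quadratic: "A x^2 - c1 = x * A x"
proof -
  have "A x^2 = (x^2 + 2 * x * R x + R x^2) / 4"
    by (simp add: A_def power2_eq_square field_simps)
  also have "\<dots> = x * A x + c1" unfolding R_sq by (simp add: A_def power2_eq_square field_simps)
  finally show ?thesis by simp
qed

lemma R_deriv: "(R has_real_derivative x / R x) (at x)"
proof -
  have "x^2 + 4*c1 > 0" using c1 by (simp add: add_nonneg_pos)
  then show ?thesis unfolding R_def[abs_def]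
    by (auto intro!: derivative_eq_intros simp: field_simps)
qed

lemma A_deriv: "(A has_real_derivative A1 x) (at x)"
  unfolding A_def[abs_def]
  by (rule derivative_eq_intros R_deriv refl)+
    (use R_pos[of x] in \<open>simp_all add: A1_def A_def divide_simps\<close>)

lemma A1_deriv: "(A1 has_real_derivative A2 x) (at x)"
proof -
  have "(A1 has_real_derivative (A1 x * R x - A x * (x / R x)) / (R x * R x)) (at x)"
    unfolding A1_def[abs_def] using R_pos[of x] A_deriv R_deriv
    by (auto intro!: derivative_eq_intros simp: A1_def)
  also have "(A1 x * R x - A x * (x / R x)) / (R x * R x) = A x * (R x - x) / R x^3"
    using R_pos[of x] by (simp add: A1_def field_simps power3_eq_cube)
  \<comment> \<open>\<open>A x\<close> is half of \<open>R x + x\<close>, so this is a difference of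
    squares; by \<open>R_sq\<close> it equals \<open>2 * c1\<close>.\<close>
  also have "A x * (R x - x) = (R x^2 - x^2) / 2"
    by (simp add: A_def power2_eq_square field_simps)
  finally show ?thesis by (simp add: A2_def R_sq)
qed

lemma continuous_A2: "continuous_on UNIV A2"
proof -
  have "continuous_on UNIV R" by (rule DERIV_continuous_on[OF has_field_derivative_at_within, OF R_deriv])
  then show ?thesis unfolding A2_def[abs_def]
    using R_pos by (auto intro!: continuous_intros simp: less_imp_neq[symmetric])
qed

section \<open>The profile curve and its derivatives\<close>

definition al :: "real \<Rightarrow> real" where "al t = A (u t)"
definition al1 :: "real \<Rightarrow> real" where "al1 t = A1 (u t) * u1 t"
definition al2 :: "real \<Rightarrow> real" where "al2 t = A2 (u t) * u1 t * u1 t + A1 (u t) * u2 t"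
text \<open>Chosen so that \<open>(al1, be1)\<close> is the positive multiple
  \<open>A1 (u t)\<close> of \<open>(u1, w1)\<close>: profile and gauge circle have parallel
  tangents at equal angles.\<close>

definition be1 :: "real \<Rightarrow> real" where "be1 t = A1 (u t) * w1 t"
definition be2 :: "real \<Rightarrow> real" where "be2 t = A2 (u t) * u1 t * w1 t + A1 (u t) * w2 t"
text \<open>Normalized at \<open>pi/2\<close> because \<open>al\<close> equals
  \<open>sqrt c1\<close> there, the radius at which \<open>F1\<close> and \<open>F2\<close> both
  vanish.\<close>

definition be :: "real \<Rightarrow> real" where
  "be = (SOME b. (\<forall>t. (b has_real_derivative be1 t) (at t)) \<and> b (pi/2) = 0)"

lemma al_deriv: "(al has_real_derivative al1 t) (at t)"
  unfolding al_def[abs_def] al1_def by (rule DERIV_chain2[OF A_deriv u_deriv])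

lemmas continuous_al = DERIV_continuous_on[OF has_field_derivative_at_within, OF al_deriv]

lemma A1_u_deriv: "((\<lambda>t. A1 (u t)) has_real_derivative A2 (u t) * u1 t) (at t)"
  by (rule DERIV_chain2[OF A1_deriv u_deriv])

lemma al1_deriv: "(al1 has_real_derivative al2 t) (at t)"
  unfolding al1_def[abs_def] al2_def
  by (rule derivative_eq_intros A1_u_deriv u1_deriv refl)+ simp

lemma be1_deriv: "(be1 has_real_derivative be2 t) (at t)"
  unfolding be1_def[abs_def] be2_def
  by (rule derivative_eq_intros A1_u_deriv w1_deriv refl)+ simp

lemma continuous_al2: "continuous_on UNIV al2" and continuous_be2: "continuous_on UNIV be2"
proof -
  have [continuous_intros]: "continuous_on UNIV (\<lambda>t. A2 (u t))"
    by (rule continuous_on_compose2[OF continuous_A2 continuous_uw(1)]) auto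
  note [continuous_intros] = continuous_u2 continuous_w2 continuous_uw
    DERIV_continuous_on[OF has_field_derivative_at_within, OF A1_u_deriv]
  show "continuous_on UNIV al2" "continuous_on UNIV be2"
    unfolding al2_def[abs_def] be2_def[abs_def] by (intro continuous_intros)+
qed

lemma be_deriv: "(be has_real_derivative be1 t) (at t)" and be_half: "be (pi/2) = 0"
proof -
  have "\<exists>F. \<forall>x :: real. -\<infinity> < ereal x \<longrightarrow> ereal x < \<infinity> \<longrightarrow> (F has_vector_derivative be1 x) (at x)"
    by (rule einterval_antiderivative) (use be1_deriv DERIV_isCont in auto)
  then obtain F where F: "\<And>x. (F has_real_derivative be1 x) (at x)"
    by (auto simp: has_real_derivative_iff_has_vector_derivative)
  have "\<exists>b. (\<forall>t. (b has_real_derivative be1 t) (at t)) \<and> b (pi/2) = 0"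
    by (rule exI[of _ "\<lambda>t. F t - F (pi/2)"]) (auto intro!: derivative_eq_intros F)
  from someI_ex[OF this]
  show "(be has_real_derivative be1 t) (at t)" "be (pi/2) = 0" by (auto simp: be_def)
qed

lemmas continuous_be = DERIV_continuous_on[OF has_field_derivative_at_within, OF be_deriv]

lemma regular: "(al1 t, be1 t) \<noteq> (0, 0)"
proof -
  have "cos t \<noteq> 0 \<or> sin t \<noteq> 0" using sin_cos_squared_add[of t] by (cases "cos t = 0") auto
  then show ?thesis using A1_pos[of "u t"] K_pos[of t]
    by (auto simp: al1_def be1_def u1_def w1_def)
qed

text \<open>At these angles \<open>u\<close> is -1, 0 and 1, and the corresponding quadratics have
  positive roots \<open>b1 c1\<close>, \<open>sqrt c1\<close> and \<open>b4 c1\<close>.\<close>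

lemma al_0: "al 0 = b1 c1" and al_half: "al (pi/2) = sqrt c1" and al_pi: "al pi = b4 c1"
proof -
  have "P 0 = 1" "P pi = 1" using m by (simp_all add: P_def)
  then have "u 0 = - 1" "u pi = 1" "u (pi/2) = 0" by (simp_all add: u_def M_def)
  then show "al 0 = b1 c1" "al pi = b4 c1" "al (pi/2) = sqrt c1"
    by (simp_all add: al_def A_def R_def b1_def b4_def real_sqrt_mult)
qed

section \<open>Reflection and translation symmetries of the profile\<close>

lemma cos_periodic_int: "cos (t + of_int k * (2*pi)) = cos t"
  and sin_periodic_int: "sin (t + of_int k * (2*pi)) = sin t"
  using cos.plus_of_int[of t k] sin.plus_of_int[of t k] by simp_all

text \<open>The reflection keeps \<open>cos\<close> and flips the sign of \<open>sin\<close>, which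
  enters here only through the even power in \<open>P\<close>.\<close>

lemma al_reflect: "al (2*pi - t) = al t" and be1_reflect: "be1 (2*pi - t) = be1 t"
  by (simp_all add: al_def be1_def u_def w1_def M_def K_def P_def sin_diff cos_diff)

lemma al_periodic: "al (t + of_int k * (2*pi)) = al t"
  and be1_periodic: "be1 (t + of_int k * (2*pi)) = be1 t"
  by (simp_all only: al_def be1_def u_def w1_def M_def K_def P_def cos_periodic_int sin_periodic_int)

text \<open>Since \<open>be1\<close> is symmetric about \<open>pi\<close>, the sum of both values is
  constant. The symmetry is the source of the arcs \<open>G3\<close> and \<open>G4\<close>, with
  their shift by \<open>- 2 * d3 m c1\<close>.\<close>

lemma be_reflect: "be (2*pi - t) = 2 * be pi - be t"
proof -
  have "((\<lambda>t. be (2*pi - t) + be t) has_real_derivative be1 (2*pi - x) * (0 - 1) + be1 x) (at x)" for x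
    by (rule derivative_intros DERIV_chain2[OF be_deriv] be_deriv)+
  then have "\<forall>x. ((\<lambda>t. be (2*pi - t) + be t) has_real_derivative 0) (at x)"
    by (simp add: be1_reflect)
  from DERIV_isconst_all[OF this, of t pi] show ?thesis by simp
qed

text \<open>The increment, found by reflecting at \<open>t = 0\<close>, is the vertical translation
  \<open>2 * d1 m c1 - 2 * d3 m c1\<close> between consecutive copies of
  \<open>Gamma\<close>.\<close>

lemma be_periodic_1: "be (t + 2*pi) = be t + (2 * be pi - 2 * be 0)"
proof -
  have "((\<lambda>t. be (t + 2*pi) - be t) has_real_derivative be1 (x + 2*pi) * (1 + 0) - be1 x) (at x)" for x
    by (rule derivative_intros DERIV_chain2[OF be_deriv] be_deriv)+
  then have "\<forall>x. ((\<lambda>t. be (t + 2*pi) - be t) has_real_derivative 0) (at x)"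
    using be1_periodic[of _ 1] by simp
  from DERIV_isconst_all[OF this, of t 0] show ?thesis using be_reflect[of 0] by simp
qed

lemma be_periodic: "be (t + of_int k * (2*pi)) = be t + of_int k * (2 * be pi - 2 * be 0)"
proof (induction k rule: int_induct[where k = 0])
  case (step1 i)
  then show ?case using be_periodic_1[of "t + of_int i * (2*pi)"] by (simp add: algebra_simps)
next
  case (step2 i)
  then show ?case using be_periodic_1[of "t + of_int (i - 1) * (2*pi)"] by (simp add: algebra_simps)
qed simp

section \<open>The integrands of F1 and F2 along the profile\<close>

lemma al_strict_mono:
  assumes st: "0 \<le> s" "s < t" "t \<le> pi"
  shows "al s < al t"
proof (rule DERIV_pos_imp_increasing_open[where f = al])
  fix x assume "s < x" "x < t"
  then have "sin x > 0" using st by (intro sin_gt_zero) auto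
  then show "\<exists>y. (al has_real_derivative y) (at x) \<and> 0 < y"
    using al_deriv[of x] A1_pos[of "u x"] K_pos[of x] by (intro exI[of _ "al1 x"]) (simp add: al1_def u1_def)
qed (use st continuous_al in auto)

lemma al1_pos: "0 < t \<Longrightarrow> t < pi \<Longrightarrow> al1 t > 0"
  using sin_gt_zero[of t] A1_pos K_pos by (auto simp: al1_def u1_def)

text \<open>By \<open>uw_unit\<close> the base is \<open>(al t * w t)^(2*m)\<close>. On the open
  half period \<open>w t\<close> is positive, so the fractional power undoes the exponent
  exactly.\<close>

lemma powr_base:
  assumes "0 < t" "t < pi"
  shows "(al t^(2*m) - (u t * al t)^(2*m)) powr ((2 * real m - 1) / (2 * real m)) = (al t * w t)^(2*m-1)"
proof -
  have "w t > 0" using sin_gt_zero[of t] assms M_pos by (simp add: w_def)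
  then have pos: "al t * w t > 0" using A_pos by (simp add: al_def)
  have "al t^(2*m) * w t^(2*m) = al t^(2*m) * (1 - u t^(2*m))" using uw_unit[of t] by auto
  then have "al t^(2*m) - (u t * al t)^(2*m) = (al t * w t)^(2*m)"
    by (simp only: power_mult_distrib) (simp add: algebra_simps)
  also have "\<dots> = (al t * w t) powr real (2*m)" using pos by (simp only: powr_realpow)
  also have "\<dots> powr ((2 * real m - 1) / (2 * real m)) = (al t * w t) powr real (2*m-1)"
    unfolding powr_powr using m by simp
  also have "\<dots> = (al t * w t)^(2*m-1)" by (rule powr_realpow[OF pos])
  finally show ?thesis .
qed

text \<open>The integrand reduces to \<open>(cos t / sin t)^(2*m-1)\<close>, which is the slope
  \<open>be1 t / al1 t\<close>. The identity also holds past \<open>pi/2\<close>, where both sides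
  are negative, and so serves \<open>g2\<close> as well.\<close>

lemma g1_al:
  assumes t: "0 < t" "t < pi"
  shows "g1 m c1 (al t) * al1 t = be1 t"
proof -
  have s: "sin t > 0" using sin_gt_zero t by simp
  have e: "c1 - al t^2 = - (u t * al t)" using A_quadratic[of "u t"] by (simp add: al_def)
  have "g1 m c1 (al t) = (- (u t * al t))^(2*m-1) / (al t * w t)^(2*m-1)"
    unfolding g1_def e using powr_base[OF t] by simp
  also have "\<dots> = ((cos t * (M t * al t)) / (sin t * (M t * al t)))^(2*m-1)"
    by (simp only: power_divide) (simp add: u_def w_def mult_ac)
  also have "\<dots> = (cos t / sin t)^(2*m-1)"
    using A_pos[of "u t"] M_pos[of t] by (simp add: al_def)
  finally show ?thesis using s by (simp add: al1_def be1_def u1_def w1_def power_divide)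
qed

lemma g2_eq: "g2 m c1 x = - g1 m c1 x"
proof -
  have "(x^2 - c1)^(2*m-1) = - ((c1 - x^2)^(2*m-1))"
    using power_minus_odd[OF odd_2m1, of "c1 - x^2"] by simp
  moreover have "(x^2 - c1)^(2*m) = (c1 - x^2)^(2*m)"
    by (metis dvd_triv_left minus_diff_eq power_minus_even)
  ultimately show ?thesis by (simp add: g1_def g2_def)
qed

lemma g1_integral:
  assumes "0 \<le> t" "t \<le> pi/2"
  shows "(g1 m c1 has_integral - be t) {al t..sqrt c1}"
proof -
  have "(g1 m c1 has_integral be (pi/2) - be t) {al t..al (pi/2)}"
    by (rule has_integral_parametric[where f' = al1 and h' = be1])
      (use assms al_deriv be_deriv al1_pos g1_al continuous_al continuous_be in auto)
  then show ?thesis by (simp add: be_half al_half)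
qed

lemma g2_integral:
  assumes "pi/2 \<le> t" "t \<le> pi"
  shows "(g2 m c1 has_integral - be t) {sqrt c1..al t}"
proof -
  have "(g1 m c1 has_integral be t - be (pi/2)) {al (pi/2)..al t}"
    by (rule has_integral_parametric[where f' = al1 and h' = be1])
      (use assms al_deriv be_deriv al1_pos g1_al continuous_al continuous_be in auto)
  then have "((\<lambda>x. - g1 m c1 x) has_integral - (be t - be (pi/2))) {al (pi/2)..al t}"
    by (rule has_integral_neg)
  then show ?thesis by (simp add: be_half al_half g2_eq[abs_def])
qed

lemma F1_al: "0 \<le> t \<Longrightarrow> t \<le> pi/2 \<Longrightarrow> F1 m c1 (al t) = - be t"
  unfolding F1_def by (rule integral_unique[OF g1_integral])

lemma F2_al: "pi/2 \<le> t \<Longrightarrow> t \<le> pi \<Longrightarrow> F2 m c1 (al t) = - be t"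
  unfolding F2_def by (rule integral_unique[OF g2_integral])

lemma d1_eq: "d1 m c1 = - be 0" and d3_eq: "d3 m c1 = - be pi"
  using F1_al[of 0] F2_al[of pi] by (simp_all add: d1_def d3_def al_0 al_pi)

text \<open>On \<open>{0<..<pi}\<close> the sign of \<open>be1\<close> is that of
  \<open>cos\<close>, so \<open>be\<close> rises to its value 0 at \<open>pi/2\<close> and falls
  afterwards. The two halves give the positivity of \<open>d1\<close> and of
  \<open>d3\<close>.\<close>

lemma d1_pos: "d1 m c1 > 0"
proof -
  have "be 0 < be (pi/2)"
  proof (rule DERIV_pos_imp_increasing_open[where f = be])
    fix x :: real assume "0 < x" "x < pi/2"
    then show "\<exists>y. (be has_real_derivative y) (at x) \<and> 0 < y"
      using be_deriv[of x] cos_gt_zero[of x] A1_pos[of "u x"] K_pos[of x]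
      by (intro exI[of _ "be1 x"]) (simp add: be1_def w1_def)
  qed (use continuous_be in auto)
  then show ?thesis by (simp add: d1_eq be_half)
qed

lemma d3_pos: "d3 m c1 > 0"
proof -
  have "be pi < be (pi/2)"
  proof (rule DERIV_neg_imp_decreasing_open[where f = be])
    fix x :: real assume x: "pi/2 < x" "x < pi"
    have "cos x < 0" using cos_gt_zero[of "pi - x"] x by simp
    then have "w1 x < 0" using K_pos odd_2m1 by (simp add: w1_def mult_neg_pos power_less_zero_eq)
    then show "\<exists>y. (be has_real_derivative y) (at x) \<and> y < 0"
      using be_deriv[of x] A1_pos[of "u x"] by (intro exI[of _ "be1 x"]) (simp add: be1_def mult_pos_neg)
  qed (use continuous_be in auto)
  then show ?thesis by (simp add: d3_eq be_half)
qed

section \<open>Traversal of the curve\<close>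

lemma b1_less: "b1 c1 < sqrt c1" and less_b4: "sqrt c1 < b4 c1"
  using al_strict_mono[of 0 "pi/2"] al_strict_mono[of "pi/2" pi]
  by (simp_all add: al_0 al_half al_pi)

text \<open>Undoes the linear motion of the radius in \<open>Gamma\<close>: the three radii
  \<open>b1 c1\<close>, \<open>sqrt c1\<close>, \<open>b4 c1\<close> go to -1, 0, 1.\<close>

definition level :: "real \<Rightarrow> real" where
  "level a = (if a \<le> sqrt c1 then (a - sqrt c1) / (sqrt c1 - b1 c1)
     else (a - sqrt c1) / (b4 c1 - sqrt c1))"

text \<open>The parameter of \<open>Gamma\<close> reached at angle \<open>t\<close>: the radius
  grows while the parameter runs through \<open>{0..2}\<close> and shrinks through
  \<open>{2..4}\<close>.\<close>

definition phase :: "real \<Rightarrow> real" where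
  "phase t = (if t \<le> pi then 1 + level (al t) else 3 - level (al t))"

lemma level_less: "a < b \<Longrightarrow> level a < level b"
proof -
  assume ab: "a < b"
  have p: "sqrt c1 - b1 c1 > 0" "b4 c1 - sqrt c1 > 0" using b1_less less_b4 by simp_all
  consider "b \<le> sqrt c1" | "a \<le> sqrt c1" "sqrt c1 < b" | "sqrt c1 < a" by linarith
  then show ?thesis
  proof cases
    case 2
    then have "level a \<le> 0" "level b > 0"
      using p by (auto simp: level_def divide_nonpos_pos)
    then show ?thesis by simp
  qed (use ab p in \<open>auto simp: level_def divide_strict_right_mono\<close>)
qed

lemma level_ends: "level (b1 c1) = - 1" "level (sqrt c1) = 0" "level (b4 c1) = 1"
  using b1_less less_b4 by (auto simp: level_def field_simps)

lemma level_ge: "a \<ge> sqrt c1 \<Longrightarrow> level a = (a - sqrt c1) / (b4 c1 - sqrt c1)"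
  by (cases "a = sqrt c1") (auto simp: level_def)

lemma level_onto:
  assumes "y \<in> {-1..1}"
  shows "\<exists>a\<in>{b1 c1..b4 c1}. level a = y"
proof (cases "y \<le> 0")
  case True
  let ?a = "sqrt c1 + y * (sqrt c1 - b1 c1)"
  have "y * (sqrt c1 - b1 c1) \<le> 0" "(-1) * (sqrt c1 - b1 c1) \<le> y * (sqrt c1 - b1 c1)"
    using mult_right_mono[of y 0 "sqrt c1 - b1 c1"] mult_right_mono[of "-1" y "sqrt c1 - b1 c1"]
      True assms b1_less by simp_all
  then have "?a \<in> {b1 c1..b4 c1}" "?a \<le> sqrt c1" using less_b4 by simp_all
  moreover from this have "level ?a = y" using b1_less by (simp add: level_def)
  ultimately show ?thesis by blast
next
  case False
  let ?a = "sqrt c1 + y * (b4 c1 - sqrt c1)"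
  have "y * (b4 c1 - sqrt c1) \<ge> 0" "y * (b4 c1 - sqrt c1) \<le> 1 * (b4 c1 - sqrt c1)"
    using False assms less_b4 by (auto intro: mult_right_mono)
  then have "?a \<in> {b1 c1..b4 c1}" "?a \<ge> sqrt c1" using b1_less by simp_all
  moreover from this have "level ?a = y" using less_b4 by (simp add: level_ge)
  ultimately show ?thesis by blast
qed

lemma phase_reflect: "t \<in> {0..2*pi} \<Longrightarrow> phase (2*pi - t) = 4 - phase t"
  \<comment> \<open>At \<open>t = pi\<close> both angles use the first branch, and the claim reads
    \<open>2 = 4 - 2\<close>.\<close>
  by (cases "t = pi") (auto simp: phase_def al_reflect al_pi level_ends)

lemma phase_less: "0 \<le> s \<Longrightarrow> s < t \<Longrightarrow> t \<le> pi \<Longrightarrow> phase s < phase t"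
  using level_less[OF al_strict_mono] by (simp add: phase_def)

lemma phase_0: "phase 0 = 0" and phase_half: "phase (pi/2) = 1" and phase_pi: "phase pi = 2"
  by (simp_all add: phase_def al_0 al_half al_pi level_ends)

text \<open>The first half follows \<open>al\<close>, the second is its reflection, and the halves
  meet at \<open>pi\<close>.\<close>

lemma phase_strict_mono: "strict_mono_on {0..2*pi} phase"
proof (rule strict_mono_onI)
  have right: "phase s < phase t" if "pi \<le> s" "s < t" "t \<le> 2*pi" for s t
    using phase_less[of "2*pi - t" "2*pi - s"] phase_reflect[of s] phase_reflect[of t] that by simp
  fix s t assume st: "s \<in> {0..2*pi}" "t \<in> {0..2*pi}" "s < t"
  consider "t \<le> pi" | "s \<le> pi" "pi < t" | "pi < s" by linarith
  then show "phase s < phase t"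
  proof cases
    case 2
    then have "phase s \<le> phase pi" using phase_less[of s pi] st by (cases "s = pi") auto
    also have "phase pi < phase t" using right[of pi t] 2 st by simp
    finally show ?thesis .
  qed (use st phase_less right in auto)
qed

text \<open>The intermediate value theorem for \<open>al\<close> yields the values up to 2, and the
  reflection yields the others.\<close>

lemma phase_onto: "{0..4} \<subseteq> phase ` {0..2*pi}"
proof
  have left: "\<exists>t\<in>{0..pi}. phase t = y" if "y \<in> {0..2}" for y
  proof -
    have "\<exists>a\<in>{b1 c1..b4 c1}. level a = y - 1" by (rule level_onto) (use that in auto)
    then obtain a where a: "a \<in> {b1 c1..b4 c1}" "level a = y - 1" by blast
    then obtain t where "0 \<le> t" "t \<le> pi" "al t = a"
      using IVT'[of al 0 a pi] continuous_al by (auto simp: al_0 al_pi)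
    then show ?thesis using a by (intro bexI[of _ t]) (auto simp: phase_def)
  qed
  fix y :: real assume y: "y \<in> {0..4}"
  show "y \<in> phase ` {0..2*pi}"
  proof (cases "y \<le> 2")
    case True
    then obtain t where "t \<in> {0..pi}" "phase t = y" using left[of y] y by auto
    then show ?thesis by (intro image_eqI[of _ _ t]) auto
  next
    case False
    then obtain t where "t \<in> {0..pi}" "phase t = 4 - y" using left[of "4 - y"] y by auto
    then show ?thesis using phase_reflect[of t] by (intro image_eqI[of _ _ "2*pi - t"]) auto
  qed
qed

sublocale monotone_period "2*pi" 4 phase
  by unfold_locales (use phase_strict_mono phase_0 phase_reflect[of 0] in auto)

text \<open>The four quarters of the period trace \<open>G1\<close> to \<open>G4\<close>. On the
  first two, \<open>F1_al\<close> and \<open>F2_al\<close> give the height; on the last two they are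
  applied at the reflected angle and combined with \<open>be_reflect\<close>.\<close>

lemma Gamma_phase:
  assumes t: "t \<in> {0..2*pi}"
  shows "Gamma m c1 (phase t) = (al t, be t)"
proof -
  have p: "sqrt c1 - b1 c1 > 0" "b4 c1 - sqrt c1 > 0" using b1_less less_b4 by simp_all
  have phase_less': "phase x < phase y" if "0 \<le> x" "x < y" "y \<le> 2*pi" for x y
    using strict_mono_onD[OF phase_strict_mono] that by auto
  have phase_mono: "phase x \<le> phase y" if "0 \<le> x" "x \<le> y" "y \<le> 2*pi" for x y
    using phase_less'[of x y] that by (cases "x = y") auto
  have al_mono: "al x \<le> al y" if "0 \<le> x" "x \<le> y" "y \<le> pi" for x y
    using al_strict_mono[of x y] that by (cases "x = y") auto
  have phase_32: "phase (3*pi/2) = 3" using phase_reflect[of "pi/2"] phase_half by simp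
  \<comment> \<open>Each junction belongs to the earlier quarter, matching the non-strict tests in
    \<open>Gamma\<close>.\<close>
  consider "t \<le> pi/2" | "pi/2 < t" "t \<le> pi" | "pi < t" "t \<le> 3*pi/2" | "3*pi/2 < t" by linarith
  then show ?thesis
  proof cases
    case 1
    have "phase t \<le> 1" using phase_mono[of t "pi/2"] phase_half 1 t by simp
    moreover have "al t \<le> sqrt c1"
      using al_mono[of t "pi/2"] al_half 1 t by simp
    moreover have "phase t = 1 + (al t - sqrt c1) / (sqrt c1 - b1 c1)"
      using 1 t \<open>al t \<le> _\<close> by (simp add: phase_def level_def)
    then have "b1 c1 + phase t * (sqrt c1 - b1 c1) = al t" using p by (simp add: field_simps)
    ultimately show ?thesis using F1_al[of t] 1 t by (simp add: Gamma_def Let_def)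
  next
    case 2
    have "phase t \<le> 2" using phase_mono[of t pi] phase_pi 2 by simp
    moreover have "phase t > 1" using phase_less'[of "pi/2" t] phase_half 2 by simp
    moreover have "al t \<ge> sqrt c1" using al_strict_mono[of "pi/2" t] al_half 2 by simp
    then have "phase t = 1 + (al t - sqrt c1) / (b4 c1 - sqrt c1)"
      using 2 by (simp add: phase_def level_ge)
    then have "sqrt c1 + (phase t - 1) * (b4 c1 - sqrt c1) = al t" using p by (simp add: field_simps)
    ultimately show ?thesis using F2_al[of t] 2 by (simp add: Gamma_def Let_def)
  next
    case 3
    let ?s = "2*pi - t"
    have s: "pi/2 \<le> ?s" "?s < pi" using 3 by auto
    have "phase t \<le> 3" using phase_mono[of t "3*pi/2"] phase_32 3 by simp
    moreover have "phase t > 2" using phase_less'[of pi t] phase_pi 3 by simp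
    moreover have "al ?s \<ge> sqrt c1"
      using al_mono[of "pi/2" ?s] al_half s by simp
    then have "phase t = 3 - (al t - sqrt c1) / (b4 c1 - sqrt c1)"
      using 3 by (simp add: phase_def level_ge al_reflect)
    then have "b4 c1 - (phase t - 2) * (b4 c1 - sqrt c1) = al t" using p by (simp add: field_simps)
    ultimately show ?thesis using F2_al[of ?s] s be_reflect[of t]
      by (simp add: Gamma_def Let_def al_reflect d3_eq)
  next
    case 4
    let ?s = "2*pi - t"
    have s: "0 \<le> ?s" "?s < pi/2" using 4 t by auto
    have "phase t > 3" using phase_less'[of "3*pi/2" t] phase_32 4 t by simp
    moreover have "al ?s \<le> sqrt c1" using al_strict_mono[of ?s "pi/2"] al_half s by simp
    then have "phase t = 3 - (al t - sqrt c1) / (sqrt c1 - b1 c1)"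
      using 4 pi_gt_zero by (simp add: phase_def level_def al_reflect del: pi_gt_zero)
    then have "sqrt c1 - (phase t - 3) * (sqrt c1 - b1 c1) = al t" using p by (simp add: field_simps)
    ultimately show ?thesis using F1_al[of ?s] s be_reflect[of t]
      by (simp add: Gamma_def Let_def al_reflect d3_eq)
  qed
qed

lemma Gamma_star_phase: "Gamma_star m c1 (quasi_periodic (2*pi) 4 phase t) = (al t, be t)"
proof -
  define k where "k = \<lfloor>t / (2*pi)\<rfloor>"
  define r where "r = t - 2*pi * k"
  have r: "r \<in> {0..<2*pi}" unfolding r_def k_def by (rule floor_remainder) simp
  have t: "t = r + of_int k * (2*pi)" by (simp add: r_def)
  have "\<lfloor>quasi_periodic (2*pi) 4 phase t / 4\<rfloor> = k"
    unfolding k_def by (rule floor_quasi_periodic)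
  moreover have "quasi_periodic (2*pi) 4 phase t = phase r + 4 * of_int k"
    by (simp add: quasi_periodic_def r_def k_def)
  ultimately have "Gamma_star m c1 (quasi_periodic (2*pi) 4 phase t)
      = (al r, be r + of_int k * (2 * be pi - 2 * be 0))"
    using Gamma_phase[of r] r by (simp add: Gamma_star_def Let_def d1_eq d3_eq)
  then show ?thesis unfolding t al_periodic be_periodic .
qed

section \<open>The Birkhoff--Gauss map\<close>

definition bg :: "real \<times> real \<Rightarrow> real^3" where
  "bg p = vector [u (fst p) * cos (snd p), u (fst p) * sin (snd p), w (fst p)]"
definition bg_t :: "real \<times> real \<Rightarrow> real^3" where
  "bg_t p = vector [u1 (fst p) * cos (snd p), u1 (fst p) * sin (snd p), w1 (fst p)]"
definition bg_v :: "real \<times> real \<Rightarrow> real^3" where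
  "bg_v p = vector [- u (fst p) * sin (snd p), u (fst p) * cos (snd p), 0]"

text \<open>Parallel tangents again: the differential of \<open>bg\<close> scales the meridian
  direction by \<open>1 / A1 (u t)\<close>.\<close>

lemma ptl_t_rot: "ptl_t (rot_surface al be) p = A1 (u (fst p)) *\<^sub>R bg_t p"
proof -
  have "((\<lambda>t. rot_surface al be (t, snd p)) has_vector_derivative
      vector [al1 (fst p) * cos (snd p), al1 (fst p) * sin (snd p), be1 (fst p)]) (at (fst p))"
    unfolding rot_surface_def fst_conv snd_conv
    by (rule has_vector_derivative_vector_3) (auto intro!: derivative_eq_intros al_deriv be_deriv)
  then have "ptl_t (rot_surface al be) p =
      vector [al1 (fst p) * cos (snd p), al1 (fst p) * sin (snd p), be1 (fst p)]"
    unfolding ptl_t_def by (rule vector_derivative_at)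
  then show ?thesis by (simp add: bg_t_def al1_def be1_def vec_eq_iff forall_3)
qed

lemma ptl_v_rot: "ptl_v (rot_surface al be) p =
  vector [- al (fst p) * sin (snd p), al (fst p) * cos (snd p), 0]"
proof -
  have "((\<lambda>v. rot_surface al be (fst p, v)) has_vector_derivative
      vector [- al (fst p) * sin (snd p), al (fst p) * cos (snd p), 0]) (at (snd p))"
    unfolding rot_surface_def fst_conv snd_conv
    by (rule has_vector_derivative_vector_3) (auto intro!: derivative_eq_intros)
  then show ?thesis unfolding ptl_v_def by (rule vector_derivative_at)
qed

text \<open>Both vectors are tangent to circles about the axis, so the second principal curvature is
  the ratio \<open>u / al\<close> of signed radii.\<close>

lemma bg_v_rot: "bg_v p = (u (fst p) / al (fst p)) *\<^sub>R ptl_v (rot_surface al be) p"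
  using A_pos[of "u (fst p)"] by (simp add: bg_v_def ptl_v_rot al_def vec_eq_iff forall_3)

lemma bg_unit: "Phi m (bg p) = 1"
proof -
  have "(u (fst p) * cos (snd p))^2 + (u (fst p) * sin (snd p))^2
      = u (fst p)^2 * ((sin (snd p))^2 + (cos (snd p))^2)"
    by (simp only: power_mult_distrib distrib_left add.commute)
  then have "Phi m (bg p) = u (fst p)^(2*m) + w (fst p)^(2*m)"
    by (simp add: Phi_def bg_def power_mult)
  then show ?thesis by (simp only: uw_unit)
qed

text \<open>Up to positive factors, both sides are the vector with entries
  \<open>- cos t^q * cos v\<close>, \<open>- cos t^q * sin v\<close>, \<open>sin t^q\<close>. The
  sign chosen in \<open>u\<close> makes the orientations agree.\<close>

lemma bg_gradient:
  "\<exists>\<mu>>0. grad_Phi m (bg p) = \<mu> *\<^sub>R cross3 (ptl_t (rot_surface al be) p) (ptl_v (rot_surface al be) p)"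
proof -
  define q where "q = 2*m-1"
  obtain t v where p: "p = (t, v)" by (cases p)
  have pos: "al t > 0" "A1 (u t) > 0" "K t > 0" "M t > 0"
    using A_pos A1_pos K_pos M_pos by (simp_all add: al_def)
  have uw: "u t^q = - (cos t^q * M t^q)" "w t^q = sin t^q * M t^q"
    using power_minus_odd[OF odd_2m1, of "cos t * M t"]
    by (simp_all add: u_def w_def q_def power_mult_distrib)
  have q: "q = Suc (2 * (m - 1))" using m by (simp add: q_def)
  have "(u t * cos v)^2 + (u t * sin v)^2 = u t^2 * ((sin v)^2 + (cos v)^2)"
    by (simp only: power_mult_distrib distrib_left add.commute)
  then have rad: "((u t * cos v)^2 + (u t * sin v)^2)^(m-1) * u t = u t^q"
    unfolding q by (simp add: power_mult mult.commute)
  have grad: "grad_Phi m (bg p) = (2 * real m) *\<^sub>R vector [u t^q * cos v, u t^q * sin v, w t^q]"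
    using rad by (simp add: grad_Phi_def bg_def p q_def mult.assoc[symmetric])
  have "cross3 (ptl_t (rot_surface al be) p) (ptl_v (rot_surface al be) p)
      = (A1 (u t) * al t * K t) *\<^sub>R
        vector [- (cos t^q) * cos v, - (cos t^q) * sin v, sin t^q * ((sin v)^2 + (cos v)^2)]"
    by (simp add: ptl_t_rot ptl_v_rot p bg_t_def cross3_def vec_eq_iff forall_3 u1_def w1_def
        q_def power2_eq_square algebra_simps del: sin_cos_squared_add3)
  then have cross: "cross3 (ptl_t (rot_surface al be) p) (ptl_v (rot_surface al be) p)
      = (A1 (u t) * al t * K t) *\<^sub>R vector [- (cos t^q) * cos v, - (cos t^q) * sin v, sin t^q]"
    by simp
  show ?thesis
  \<comment> \<open>The witness is the quotient of the two scalar factors,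
    \<open>2 * real m * M t^q\<close> from the gradient and \<open>A1 (u t) * al t * K t\<close>
    from the cross product.\<close>
  proof (intro exI[of _ "2 * real m * M t^q / (A1 (u t) * al t * K t)"] conjI)
    show "0 < 2 * real m * M t^q / (A1 (u t) * al t * K t)" using pos m by simp
    show "grad_Phi m (bg p) = (2 * real m * M t^q / (A1 (u t) * al t * K t)) *\<^sub>R
        cross3 (ptl_t (rot_surface al be) p) (ptl_v (rot_surface al be) p)"
      unfolding grad cross uw using pos by (simp add: vec_eq_iff forall_3)
  qed
qed

lemma is_BG_map_bg: "is_BG_map m (rot_surface al be) D bg"
  unfolding is_BG_map_def has_derivative_Phi_iff using bg_unit bg_gradient by blast

text \<open>Both gradients are positive multiples of one normal, hence of each other, and
  \<open>unit_sphere_eqI\<close> applies.\<close>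

lemma is_BG_map_unique:
  assumes "is_BG_map m (rot_surface al be) D \<eta>" and p: "p \<in> D"
  shows "\<eta> p = bg p"
proof -
  let ?n = "cross3 (ptl_t (rot_surface al be) p) (ptl_v (rot_surface al be) p)"
  obtain \<mu> where 1: "\<mu> > 0" "Phi m (\<eta> p) = 1" "grad_Phi m (\<eta> p) = \<mu> *\<^sub>R ?n"
    using assms unfolding is_BG_map_def has_derivative_Phi_iff by blast
  obtain \<nu> where 2: "\<nu> > 0" "grad_Phi m (bg p) = \<nu> *\<^sub>R ?n"
    using bg_gradient by blast
  have "grad_Phi m (\<eta> p) = (\<mu> / \<nu>) *\<^sub>R grad_Phi m (bg p)" using 1 2 by simp
  moreover have "\<mu> / \<nu> > 0" using 1 2 by simp
  ultimately show ?thesis using unit_sphere_eqI[OF m 1(2) bg_unit] by blast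
qed

lemma bg_deriv: "(bg has_derivative (\<lambda>h. fst h *\<^sub>R bg_t p + snd h *\<^sub>R bg_v p)) (at p within D)"
proof -
  have uf: "((\<lambda>p. u (fst p)) has_derivative (\<lambda>h. u1 (fst p) * fst h)) (at p within D)"
    by (rule has_derivative_compose[OF has_derivative_fst[OF has_derivative_ident]
          u_deriv[unfolded has_field_derivative_def]])
  have wf: "((\<lambda>p. w (fst p)) has_derivative (\<lambda>h. w1 (fst p) * fst h)) (at p within D)"
    by (rule has_derivative_compose[OF has_derivative_fst[OF has_derivative_ident]
          w_deriv[unfolded has_field_derivative_def]])
  have "(bg has_derivative (\<lambda>h. vector [
      u (fst p) * (- sin (snd p) * snd h) + u1 (fst p) * fst h * cos (snd p),
      u (fst p) * (cos (snd p) * snd h) + u1 (fst p) * fst h * sin (snd p), w1 (fst p) * fst h]))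
      (at p within D)"
    unfolding bg_def[abs_def]
    by (rule has_derivative_vector_3[OF _ _ wf])
      (auto intro!: derivative_eq_intros uf simp: fun_eq_iff algebra_simps)
  also have "(\<lambda>h. vector [
      u (fst p) * (- sin (snd p) * snd h) + u1 (fst p) * fst h * cos (snd p),
      u (fst p) * (cos (snd p) * snd h) + u1 (fst p) * fst h * sin (snd p), w1 (fst p) * fst h])
      = (\<lambda>h. fst h *\<^sub>R bg_t p + snd h *\<^sub>R bg_v p)"
    by (rule ext) (simp add: bg_t_def bg_v_def vec_eq_iff forall_3 algebra_simps)
  finally show ?thesis .
qed

lemma C1_on_bg: "C1_on D bg"
proof -
  define D' where "D' p = Blinfun (\<lambda>h. fst h *\<^sub>R bg_t p + snd h *\<^sub>R bg_v p)" for p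
  have ap: "blinfun_apply (D' p) = (\<lambda>h. fst h *\<^sub>R bg_t p + snd h *\<^sub>R bg_v p)" for p
    unfolding D'_def by (rule bounded_linear_Blinfun_apply) (rule has_derivative_bounded_linear[OF bg_deriv])
  have c: "continuous_on D (\<lambda>p. g (fst p))" if "continuous_on UNIV g" for g :: "real \<Rightarrow> real"
    by (rule continuous_on_compose2[OF that]) (auto intro: continuous_intros)
  have "continuous_on D bg_t" "continuous_on D bg_v"
    unfolding bg_t_def[abs_def] bg_v_def[abs_def]
    by (intro continuous_on_vector_3 continuous_intros c continuous_uw)+
  \<comment> \<open>In finite dimension it suffices to test the derivative on basis vectors, which
    gives combinations of \<open>bg_t\<close> and \<open>bg_v\<close>.\<close>
  then have "continuous_on D D'"
    by (intro continuous_on_blinfun_componentwise) (auto simp: ap intro!: continuous_intros)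
  then show ?thesis unfolding C1_on_def using bg_deriv ap by (intro exI[of _ D']) auto
qed

text \<open>In the basis of partial derivatives the differential is diagonal with entries
  \<open>R / A\<close> and \<open>x / A\<close> at \<open>x = u t\<close>. They add up to 2 because
  \<open>A x\<close> is half of \<open>x + R x\<close>.\<close>

lemma mean_curvature_bg:
  assumes "D = UNIV \<times> {0..2*pi}" and p: "p \<in> D"
  shows "mink_mean_curv_is (rot_surface al be) D bg p 1"
  unfolding mink_mean_curv_is_def
proof (intro allI impI)
  fix L assume L: "(bg has_derivative L) (at p within D)"
  have "L = (\<lambda>h. fst h *\<^sub>R bg_t p + snd h *\<^sub>R bg_v p)"
  proof (rule frechet_derivative_unique_within[OF L bg_deriv])
    fix i :: "real \<times> real" and e :: real
    assume i: "i \<in> Basis" and e: "e > 0"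
    \<comment> \<open>The strip has boundary, so uniqueness of the derivative needs small axis
      displacements that stay inside. Moving up below \<open>pi\<close> and down otherwise, by at
      most \<open>pi\<close>, remains in \<open>{0..2*pi}\<close>.\<close>
    define d where "d = (if snd p < pi then min (e/2) pi else - min (e/2) pi)"
    have "0 < \<bar>d\<bar>" "\<bar>d\<bar> < e" using e pi_gt_zero by (auto simp: d_def min_def)
    moreover have "p + d *\<^sub>R i \<in> D"
      using i p e pi_gt_zero unfolding assms(1)
      by (cases p) (auto simp: Basis_prod_def d_def min_def)
    ultimately show "\<exists>d. 0 < \<bar>d\<bar> \<and> \<bar>d\<bar> < e \<and> p + d *\<^sub>R i \<in> D" by blast
  qed
  then have L: "L (1, 0) = bg_t p" "L (0, 1) = bg_v p" by simp_all
  let ?x = "u (fst p)"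
  have "1 / A1 ?x + ?x / al (fst p) = (R ?x + ?x) / A ?x"
    by (simp add: A1_def al_def add_divide_distrib)
  also have "\<dots> = 2" using A_pos[of ?x] by (simp add: A_def field_simps)
  finally have "(1 / A1 ?x + ?x / al (fst p)) / 2 = 1" by simp
  then show "\<exists>a b c d. L (1, 0) = a *\<^sub>R ptl_t (rot_surface al be) p + b *\<^sub>R ptl_v (rot_surface al be) p
      \<and> L (0, 1) = c *\<^sub>R ptl_t (rot_surface al be) p + d *\<^sub>R ptl_v (rot_surface al be) p
      \<and> (a + d) / 2 = 1"
    using A1_pos[of ?x]
    by (intro exI[of _ "1 / A1 ?x"] exI[of _ 0] exI[of _ "?x / al (fst p)"])
      (simp add: L ptl_t_rot bg_v_rot)
qed

end

theorem theorem6p3: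
  fixes m :: nat and c1 :: real
  assumes "m \<ge> 2" and "c1 > 0"
  shows "b1 c1 < sqrt c1 \<and> sqrt c1 < b4 c1
    \<and> g1 m c1 integrable_on {b1 c1..sqrt c1}
    \<and> g2 m c1 integrable_on {sqrt c1..b4 c1}
    \<and> d1 m c1 > 0 \<and> d3 m c1 > 0
    \<and> (\<exists>\<alpha> \<beta> \<alpha>1 \<alpha>2 \<beta>1 \<beta>2 \<phi>.
         (\<forall>t. (\<alpha> has_real_derivative \<alpha>1 t) (at t) \<and> (\<alpha>1 has_real_derivative \<alpha>2 t) (at t)
            \<and> (\<beta> has_real_derivative \<beta>1 t) (at t) \<and> (\<beta>1 has_real_derivative \<beta>2 t) (at t))
       \<and> continuous_on UNIV \<alpha>2 \<and> continuous_on UNIV \<beta>2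
       \<and> (\<forall>t. (\<alpha>1 t, \<beta>1 t) \<noteq> (0, 0))
       \<and> strict_mono \<phi> \<and> continuous_on UNIV \<phi> \<and> surj \<phi>
       \<and> (\<forall>t. (\<alpha> t, \<beta> t) = Gamma_star m c1 (\<phi> t))
       \<and> (let f = rot_surface \<alpha> \<beta>; D = UNIV \<times> {0..2*pi} in
            (\<exists>\<eta>. is_BG_map m f D \<eta>)
          \<and> (\<forall>\<eta>. is_BG_map m f D \<eta> \<longrightarrow>
                 C1_on D \<eta> \<and> (\<forall>p\<in>D. mink_mean_curv_is f D \<eta> p 1))))"
proof -
  interpret profile m c1 by unfold_locales (use assms in auto)
  let ?\<phi> = "quasi_periodic (2*pi) 4 phase"
  let ?f = "rot_surface al be" and ?D = "(UNIV :: real set) \<times> {0..2*pi}"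
  have surj: "surj ?\<phi>" by (rule surj_quasi_periodic[OF phase_onto])
  \<comment> \<open>A monotone surjection onto the line has no jumps.\<close>
  have cont: "continuous_on UNIV ?\<phi>"
    by (rule continuous_onI_mono)
      (use surj strict_mono_less_eq[OF strict_mono_quasi_periodic] in auto)
  have BG: "(\<exists>\<eta>. is_BG_map m ?f ?D \<eta>) \<and> (\<forall>\<eta>. is_BG_map m ?f ?D \<eta> \<longrightarrow>
      C1_on ?D \<eta> \<and> (\<forall>p\<in>?D. mink_mean_curv_is ?f ?D \<eta> p 1))"
  proof (intro conjI allI impI ballI)
    show "\<exists>\<eta>. is_BG_map m ?f ?D \<eta>" using is_BG_map_bg by blast
    fix \<eta> assume "is_BG_map m ?f ?D \<eta>"
    note eq = is_BG_map_unique[OF this]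
    show "C1_on ?D \<eta>" by (rule C1_on_cong[OF C1_on_bg eq])
    show "mink_mean_curv_is ?f ?D \<eta> p 1" if "p \<in> ?D" for p
      by (rule mink_mean_curv_is_cong[OF mean_curvature_bg[OF refl that] eq that])
  qed
  have ints: "g1 m c1 integrable_on {b1 c1..sqrt c1}" "g2 m c1 integrable_on {sqrt c1..b4 c1}"
    using g1_integral[of 0] g2_integral[of pi] unfolding al_0 al_pi integrable_on_def by auto
  have curve: "(\<forall>t. (al has_real_derivative al1 t) (at t) \<and> (al1 has_real_derivative al2 t) (at t)
        \<and> (be has_real_derivative be1 t) (at t) \<and> (be1 has_real_derivative be2 t) (at t))
      \<and> continuous_on UNIV al2 \<and> continuous_on UNIV be2
      \<and> (\<forall>t. (al1 t, be1 t) \<noteq> (0, 0))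
      \<and> strict_mono ?\<phi> \<and> continuous_on UNIV ?\<phi> \<and> surj ?\<phi>
      \<and> (\<forall>t. (al t, be t) = Gamma_star m c1 (?\<phi> t))"
    by (intro conjI allI al_deriv al1_deriv be_deriv be1_deriv continuous_al2 continuous_be2 regular
      strict_mono_quasi_periodic cont surj Gamma_star_phase[symmetric])
  have "\<exists>\<alpha> \<beta> \<alpha>1 \<alpha>2 \<beta>1 \<beta>2 \<phi>.
         (\<forall>t. (\<alpha> has_real_derivative \<alpha>1 t) (at t) \<and> (\<alpha>1 has_real_derivative \<alpha>2 t) (at t)
            \<and> (\<beta> has_real_derivative \<beta>1 t) (at t) \<and> (\<beta>1 has_real_derivative \<beta>2 t) (at t))
       \<and> continuous_on UNIV \<alpha>2 \<and> continuous_on UNIV \<beta>2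
       \<and> (\<forall>t. (\<alpha>1 t, \<beta>1 t) \<noteq> (0, 0))
       \<and> strict_mono \<phi> \<and> continuous_on UNIV \<phi> \<and> surj \<phi>
       \<and> (\<forall>t. (\<alpha> t, \<beta> t) = Gamma_star m c1 (\<phi> t))
       \<and> (let f = rot_surface \<alpha> \<beta>; D = UNIV \<times> {0..2*pi} in
            (\<exists>\<eta>. is_BG_map m f D \<eta>)
          \<and> (\<forall>\<eta>. is_BG_map m f D \<eta> \<longrightarrow>
                 C1_on D \<eta> \<and> (\<forall>p\<in>D. mink_mean_curv_is f D \<eta> p 1)))"
    unfolding Let_def
    by (rule exI[where x = al], rule exI[where x = be], rule exI[where x = al1],
        rule exI[where x = al2], rule exI[where x = be1], rule exI[where x = be2],
        rule exI[where x = ?\<phi>], insert curve BG, elim conjE, intro conjI)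
  then show ?thesis using b1_less less_b4 d1_pos d3_pos ints by (intro conjI)
qed

end
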